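(* Let $n\ge 0$ be an integer. (i) For $\alpha\in\mathbb{C}$ with $\operatorname{Re}(\alpha)>0$ and $\lambda\in\mathbb{C}\setminus\{-1\}$, $$w_{n,\alpha}\!\left(\frac{-\lambda}{\lambda+1}\right)=\left(\frac{\lambda+1}{2}\right)^{\alpha}\mathcal{E}_{n}^{(\alpha)}(\lambda).$$ (ii) For every integer $l\ge 1$ and $\lambda\in\mathbb{C}\setminus\{1\}$, $$w_{n,l}\!\left(\frac{-\lambda}{\lambda-1}\right)=\frac{(\lambda-1)^{l}}{l!}\binom{n+l}{l}^{-1}\mathcal{B}_{n+l}^{(l)}(\lambda).$$
   Context: General geometric polynomials: $w_{n,\alpha}(x)=\sum_{k=0}^{n}\genfrac{\{}{\}}{0pt}{}{n}{k}\binom{\alpha+k-1}{k}k!\,x^k$, with $\genfrac{\{}{\}}{0pt}{}{n}{k}$ the Stirling numbers of the second kind and $\binom{\alpha+k-1}{k}=\frac{\alpha(\alpha+1)\cdots(\alpha+k-1)}{k!}$. Apostol-Euler numbers of order $\alpha$ ($\lambda\ne-1$): $\left(\frac{2}{\lambda e^t+1}\right)^\alpha=\sum_{n\ge0}\mathcal{E}_n^{(\alpha)}(\lambda)\frac{t^n}{n!}$. Branches: fix a logarithm $L$ of $\lambda+1$ (e.g. the principal one); the left side is the power series in $t$ with constant term $2^\alpha e^{-\alpha L}$, and $\left(\frac{\lambda+1}{2}\right)^\alpha:=2^{-\alpha}e^{\alpha L}$. Apostol-Bernoulli numbers of order $l$ ($l\in\mathbb{N}$): $\left(\frac{t}{\lambda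 e^t-1}\right)^l=\sum_{n\ge0}\mathcal{B}_n^{(l)}(\lambda)\frac{t^n}{n!}$. *)

theory Defs
  imports "HOL-Complex_Analysis.Complex_Analysis" "HOL-Combinatorics.Stirling"
begin

definition geom_poly :: "nat \<Rightarrow> complex \<Rightarrow> complex \<Rightarrow> complex" where
  "geom_poly n \<alpha> x =
     (\<Sum>k\<le>n. of_nat (Stirling n k) * ((\<alpha> + of_nat k - 1) gchoose k) * fact k * x ^ k)"

lemma gchoose_rising: "((\<alpha> + of_nat k - 1) gchoose k) = (\<Prod>i<k. \<alpha> + of_nat i) / fact k"
  for \<alpha> :: complex
  by (simp add: gbinomial_pochhammer' pochhammer_prod atLeast0LessThan algebra_simps)

text \<open>
  Throughout, \<open>\<mu>\<close> is the Apostol parameter usually written as lambda.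
  If \<open>exp L = \<mu> + 1\<close>, this is, near \<open>t = 0\<close>, the analytic logarithm of
  \<open>\<mu> * exp t + 1\<close> whose value at \<open>0\<close> is \<open>L\<close>: the argument of the principal
  logarithm \<open>Ln\<close> equals \<open>1\<close> at \<open>t = 0\<close>.
\<close>
definition log_branch :: "complex \<Rightarrow> complex \<Rightarrow> complex \<Rightarrow> complex" where
  "log_branch L \<mu> t = L + Ln ((\<mu> * exp t + 1) / (\<mu> + 1))"

text \<open>
  The function \<open>(2 / (\<mu> * exp t + 1)) ^ \<alpha>\<close> near \<open>t = 0\<close>, for the branch determined by the
  logarithm \<open>L\<close> of \<open>\<mu> + 1\<close>.
\<close>
definition apostol_euler_gf :: "complex \<Rightarrow> complex \<Rightarrow> complex \<Rightarrow> complex \<Rightarrow> complex" where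
  "apostol_euler_gf L \<alpha> \<mu> t = 2 powr \<alpha> * exp (- \<alpha> * log_branch L \<mu> t)"

definition apostol_euler :: "complex \<Rightarrow> nat \<Rightarrow> complex \<Rightarrow> complex \<Rightarrow> complex" where
  "apostol_euler L n \<alpha> \<mu> = fact n * fps_nth (fps_expansion (apostol_euler_gf L \<alpha> \<mu>) 0) n"

text \<open>
  The quotient and power are those of formal power series; for \<open>\<mu> \<noteq> 1\<close> the denominator is
  invertible.
\<close>
definition apostol_bernoulli :: "nat \<Rightarrow> nat \<Rightarrow> complex \<Rightarrow> complex" where
  "apostol_bernoulli n l \<mu> =
     fact n * fps_nth ((fps_X / (fps_const \<mu> * fps_exp 1 - 1)) ^ l) n"

lemma log_branch_0: "\<mu> \<noteq> -1 \<Longrightarrow> log_branch L \<mu> 0 = L"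
  by (simp add: log_branch_def add_eq_0_iff2)

lemma log_branch_analytic:
  assumes "\<mu> \<noteq> -1"
  shows "log_branch L \<mu> analytic_on {0}"
proof -
  have "\<mu> + 1 \<noteq> 0"
    using assms by (simp add: add_eq_0_iff2)
  thus ?thesis
    unfolding log_branch_def by (auto intro!: analytic_intros)
qed

lemma exp_log_branch:
  assumes "\<mu> \<noteq> -1" "exp L = \<mu> + 1"
  shows "\<forall>\<^sub>F t in nhds 0. exp (log_branch L \<mu> t) = \<mu> * exp t + 1"
proof -
  have nz: "\<mu> + 1 \<noteq> 0"
    using assms by (simp add: add_eq_0_iff2)
  have "isCont (\<lambda>t. \<mu> * exp t + 1) 0"
    by (intro continuous_intros)
  hence "((\<lambda>t. \<mu> * exp t + 1) \<longlongrightarrow> \<mu> * exp 0 + 1) (nhds 0)"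
    by (simp add: isCont_def tendsto_nhds_iff)
  hence "\<forall>\<^sub>F t in nhds 0. \<mu> * exp t + 1 \<noteq> 0"
    using nz by (intro tendsto_imp_eventually_ne) auto
  thus ?thesis
    by eventually_elim (use nz assms in \<open>simp add: log_branch_def exp_add\<close>)
qed

lemma apostol_euler_gf_0: "\<mu> \<noteq> -1 \<Longrightarrow> apostol_euler_gf L \<alpha> \<mu> 0 = 2 powr \<alpha> * exp (- \<alpha> * L)"
  by (simp add: apostol_euler_gf_def log_branch_0)

lemma apostol_euler_generating_function:
  assumes "\<mu> \<noteq> -1"
  shows "apostol_euler_gf L \<alpha> \<mu> has_fps_expansion Abs_fps (\<lambda>n. apostol_euler L n \<alpha> \<mu> / fact n)"
proof -
  have "apostol_euler_gf L \<alpha> \<mu> analytic_on {0}"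
    unfolding apostol_euler_gf_def by (intro analytic_intros log_branch_analytic assms)
  hence "apostol_euler_gf L \<alpha> \<mu> has_fps_expansion fps_expansion (apostol_euler_gf L \<alpha> \<mu>) 0"
    by (rule analytic_at_imp_has_fps_expansion_0)
  also have "fps_expansion (apostol_euler_gf L \<alpha> \<mu>) 0 = Abs_fps (\<lambda>n. apostol_euler L n \<alpha> \<mu> / fact n)"
    by (simp add: fps_eq_iff apostol_euler_def)
  finally show ?thesis .
qed

lemma apostol_bernoulli_generating_function:
  assumes "\<mu> \<noteq> 1"
  shows "(\<lambda>t. (t / (\<mu> * exp t - 1)) ^ l) has_fps_expansion
           Abs_fps (\<lambda>n. apostol_bernoulli n l \<mu> / fact n)"
proof -
  have "(\<lambda>t. (t / (\<mu> * exp (1 * t) - 1)) ^ l) has_fps_expansion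
          (fps_X / (fps_const \<mu> * fps_exp 1 - 1)) ^ l"
    using assms by (intro fps_expansion_intros) auto
  also have "(fps_X / (fps_const \<mu> * fps_exp 1 - 1)) ^ l =
               Abs_fps (\<lambda>n. apostol_bernoulli n l \<mu> / fact n)"
    by (simp add: fps_eq_iff apostol_bernoulli_def)
  finally show ?thesis
    by simp
qed

end

(* The exponential generating function of the geometric polynomials is
   (1 - x (exp t - 1)) ^ (- \<alpha>): expand it by the binomial series and use that
   (exp t - 1) ^ k / k! generates the Stirling numbers of the second kind.  At the two
   arguments of the theorem, 1 - x (exp t - 1) becomes (\<mu> exp t + 1) / (\<mu> + 1) and
   (\<mu> exp t - 1) / (\<mu> - 1), respectively. *)

theory Submission
  imports Defs
begin

text \<open>The series E = exp - 1 satisfies E' = E + 1, so the derivative of E ^ (j+1) is (j+1) (E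
  ^ (j+1) + E ^ j). On coefficients this is the Stirling recurrence, scaled by factorials.\<close>

lemma fps_exp_minus_one_power_nth:
  "fact n * (fps_exp 1 - 1 :: 'a :: field_char_0 fps) ^ k $ n = fact k * of_nat (Stirling n k)"
proof (induction n arbitrary: k)
  case 0
  show ?case
    by (cases k) (auto simp: fps_power_zeroth)
next
  case (Suc n k)
  show ?case
  proof (cases k)
    case 0
    thus ?thesis by simp
  next
    case [simp]: (Suc j)
    let ?E = "fps_exp 1 - 1 :: 'a fps"
    have "of_nat (Suc n) * ?E ^ Suc j $ Suc n = fps_deriv (?E ^ Suc j) $ n"
      by (simp only: fps_deriv_nth Suc_eq_plus1)
    also have "fps_deriv (?E ^ Suc j) = of_nat (Suc j) * (?E ^ Suc j + ?E ^ j)"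
      by (subst fps_deriv_power') (simp add: algebra_simps)
    also have "\<dots> $ n = of_nat (Suc j) * (?E ^ Suc j $ n + ?E ^ j $ n)"
      by (simp only: fps_of_nat [symmetric] fps_mult_left_const_nth fps_add_nth)
    finally have "fact (Suc n) * ?E ^ Suc j $ Suc n =
        of_nat (Suc j) * (fact n * ?E ^ Suc j $ n + fact n * ?E ^ j $ n)"
      by (simp only: fact_Suc of_nat_mult mult_ac distrib_left)
    also have "\<dots> = fact (Suc j) * of_nat (Stirling (Suc n) (Suc j))"
      by (simp only: Suc.IH) (simp add: algebra_simps)
    finally show ?thesis by simp
  qed
qed

text \<open>Upper negation gives (-1) ^ k in the k-th coefficient of
  \<open>fps_binomial (- \<alpha>)\<close>, which cancels the sign of (- x) ^ k.\<close>

lemma geom_poly_eq_fps_nth: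
  "geom_poly n \<alpha> x =
     fact n * (fps_binomial (- \<alpha>) oo (fps_const (- x) * (fps_exp 1 - 1))) $ n"
proof -
  have "fact n * (((- \<alpha>) gchoose k) * (fps_const (- x) * (fps_exp 1 - 1)) ^ k $ n) =
        of_nat (Stirling n k) * ((\<alpha> + of_nat k - 1) gchoose k) * fact k * x ^ k" for k
  proof -
    have "fact n * (((- \<alpha>) gchoose k) * (fps_const (- x) * (fps_exp 1 - 1)) ^ k $ n) =
          ((- \<alpha>) gchoose k) * (- x) ^ k * (fact n * (fps_exp 1 - 1) ^ k $ n)"
      by (simp add: power_mult_distrib fps_const_power mult_ac)
    also have "\<dots> = ((\<alpha> + of_nat k - 1) gchoose k) * ((-1) ^ k * (- x) ^ k) *
                    (fact k * of_nat (Stirling n k))"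
      by (simp only: fps_exp_minus_one_power_nth gbinomial_minus mult_ac)
    also have "(-1) ^ k * (- x) ^ k = x ^ k"
      by (simp flip: power_mult_distrib)
    finally show ?thesis
      by (simp add: mult_ac)
  qed
  thus ?thesis
    by (simp add: geom_poly_def fps_compose_nth sum_distrib_left atLeast0AtMost)
qed

lemma geom_poly_eq_apostol_euler:
  assumes \<mu>: "\<mu> \<noteq> -1" and L: "exp L = \<mu> + 1"
  shows "geom_poly n \<alpha> (- \<mu> / (\<mu> + 1)) = 2 powr (- \<alpha>) * exp (\<alpha> * L) * apostol_euler L n \<alpha> \<mu>"
proof -
  have nz: "\<mu> + 1 \<noteq> 0"
    using \<mu> by (simp add: add_eq_0_iff2)
  \<comment> \<open>Minus the argument of the geometric polynomial, so 1 + c (exp t - 1) is the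
    normalized base, with value 1 at t = 0.\<close>
  define c where "c = \<mu> / (\<mu> + 1)"
  define B where "B = fps_binomial (- \<alpha>) oo (fps_const c * (fps_exp 1 - 1))"
  have eq: "1 + c * (exp t - 1) = (\<mu> * exp t + 1) / (\<mu> + 1)" for t
    using nz by (simp add: c_def field_simps)
  have inner: "(\<lambda>t. c * (exp (1 * t) - 1)) has_fps_expansion fps_const c * (fps_exp 1 - 1)"
    by (intro fps_expansion_intros)
  have "((\<lambda>z. (1 + z) powr (- \<alpha>)) \<circ> (\<lambda>t. c * (exp (1 * t) - 1))) has_fps_expansion B"
    unfolding B_def
    by (rule has_fps_expansion_compose [OF has_fps_expansion_binomial_complex inner]) simp
  hence "(\<lambda>t. 2 powr \<alpha> * exp (- \<alpha> * L) * (1 + c * (exp t - 1)) powr (- \<alpha>))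
           has_fps_expansion fps_const (2 powr \<alpha> * exp (- \<alpha> * L)) * B"
    by (intro has_fps_expansion_cmult_left) (simp add: o_def)
  \<comment> \<open>The chosen branch enters only through the constant exp (- \<alpha> L); the
    remaining factor is a principal power of a base near 1.\<close>
  moreover have "\<forall>\<^sub>F t in nhds 0. 2 powr \<alpha> * exp (- \<alpha> * L) * (1 + c * (exp t - 1)) powr (- \<alpha>) =
                   apostol_euler_gf L \<alpha> \<mu> t"
    using exp_log_branch [OF \<mu> L]
  proof eventually_elim
    case (elim t)
    \<comment> \<open>\<open>powr\<close> unfolds to exp and \<open>Ln\<close> only at a nonzero
      base; here the numerator is a value of exp.\<close>
    hence "(\<mu> * exp t + 1) / (\<mu> + 1) \<noteq> 0"
      using nz by (metis divide_eq_0_iff exp_not_eq_zero)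
    hence "((\<mu> * exp t + 1) / (\<mu> + 1)) powr (- \<alpha>) = exp (- \<alpha> * Ln ((\<mu> * exp t + 1) / (\<mu> + 1)))"
      by (simp only: powr_def if_False)
    thus ?case
      by (simp only: eq apostol_euler_gf_def log_branch_def distrib_left exp_add mult.assoc)
  qed
  ultimately have "apostol_euler_gf L \<alpha> \<mu> has_fps_expansion fps_const (2 powr \<alpha> * exp (- \<alpha> * L)) * B"
    by (subst (asm) has_fps_expansion_cong [OF _ refl])
  hence "Abs_fps (\<lambda>n. apostol_euler L n \<alpha> \<mu> / fact n) = fps_const (2 powr \<alpha> * exp (- \<alpha> * L)) * B"
    by (rule fps_expansion_unique_complex [OF apostol_euler_generating_function [OF \<mu>]])
  hence "apostol_euler L n \<alpha> \<mu> / fact n = 2 powr \<alpha> * exp (- \<alpha> * L) * B $ n"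
    by (simp add: fps_eq_iff)
  hence "apostol_euler L n \<alpha> \<mu> = 2 powr \<alpha> * exp (- \<alpha> * L) * (fact n * B $ n)"
    by (simp add: field_simps)
  also have "fact n * B $ n = geom_poly n \<alpha> (- \<mu> / (\<mu> + 1))"
    by (simp add: geom_poly_eq_fps_nth B_def c_def)
  finally show ?thesis
    by (simp add: exp_minus powr_minus field_simps)
qed

text \<open>The exponent is a natural number, so no branch arises and the argument stays within
  formal power series.\<close>

lemma geom_poly_eq_apostol_bernoulli:
  assumes \<mu>: "\<mu> \<noteq> 1"
  shows "geom_poly n (of_nat l) (- \<mu> / (\<mu> - 1)) =
           (\<mu> - 1) ^ l / fact l * inverse (of_nat ((n + l) choose l)) * apostol_bernoulli (n + l) l \<mu>"
proof -
  have nz: "\<mu> - 1 \<noteq> 0"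
    using \<mu> by simp
  define c where "c = \<mu> / (\<mu> - 1)"
  define D where "D = fps_const \<mu> * fps_exp 1 - 1"
  let ?E = "fps_const c * (fps_exp 1 - 1)"
  have D0: "D $ 0 \<noteq> 0"
    using nz by (simp add: D_def)
  \<comment> \<open>The constant coefficient is 1 on both sides; for m > 0 both are c / m!.\<close>
  have "(1 + ?E) $ m = (fps_const (inverse (\<mu> - 1)) * D) $ m" for m
    using nz by (cases m) (simp_all add: D_def c_def divide_inverse_commute)
  hence "1 + ?E = fps_const (inverse (\<mu> - 1)) * D"
    by (rule fps_ext)
  moreover have "fps_binomial (- of_nat l) oo ?E = inverse ((1 + ?E) ^ l)"
    by (simp add: fps_binomial_minus_of_nat fps_inverse_compose fps_compose_power [symmetric]
        fps_compose_add_distrib fps_power_zeroth)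
  ultimately have B: "fps_binomial (- of_nat l) oo ?E = fps_const ((\<mu> - 1) ^ l) * inverse D ^ l"
    by (simp add: power_mult_distrib fps_inverse_mult fps_inverse_power fps_const_inverse
        flip: power_inverse)
  \<comment> \<open>\<open>D\<close> is a unit, so the factor \<open>fps_X ^ l\<close> merely shifts
    coefficients; this accounts for the index n + l.\<close>
  have "(fps_X / D) ^ l = fps_X ^ l * inverse D ^ l"
    using D0 by (simp add: fps_divide_unit power_mult_distrib)
  hence "apostol_bernoulli (n + l) l \<mu> = fact (n + l) * (inverse D ^ l) $ n"
    by (simp add: apostol_bernoulli_def D_def fps_X_power_mult_nth)
  moreover have "geom_poly n (of_nat l) (- \<mu> / (\<mu> - 1)) = fact n * ((\<mu> - 1) ^ l * (inverse D ^ l) $ n)"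
    using B by (simp add: geom_poly_eq_fps_nth c_def)
  moreover have "of_nat ((n + l) choose l) = (fact (n + l) / (fact l * fact n) :: complex)"
    by (simp add: binomial_fact)
  ultimately show ?thesis
    by (simp add: field_simps)
qed

theorem mainTheorem7:
  fixes n :: nat
  shows "(\<forall>\<alpha> \<mu> L :: complex. Re \<alpha> > 0 \<longrightarrow> \<mu> \<noteq> -1 \<longrightarrow> exp L = \<mu> + 1 \<longrightarrow>
            geom_poly n \<alpha> (- \<mu> / (\<mu> + 1)) =
              2 powr (- \<alpha>) * exp (\<alpha> * L) * apostol_euler L n \<alpha> \<mu>) \<and>
         (\<forall>(l :: nat) (\<mu> :: complex). l \<ge> 1 \<longrightarrow> \<mu> \<noteq> 1 \<longrightarrow>
            geom_poly n (of_nat l) (- \<mu> / (\<mu> - 1)) =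
              (\<mu> - 1) ^ l / fact l * inverse (of_nat ((n + l) choose l)) *
                apostol_bernoulli (n + l) l \<mu>)"
  using geom_poly_eq_apostol_euler geom_poly_eq_apostol_bernoulli by blast

end
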